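(* Let $\mathcal S=\{i_1,\dots,i_M\}$, $i_1<\dots<i_M$, let $\underline b=(b_2,\dots,b_{M-1})$ satisfy $-\frac{1}{i_{j+1}-i_j}<b_j<\frac{1}{i_j-i_{j-1}}$ for $j=2,\dots,M-1$, and let $\underline k,\underline\lambda\in\mathbb R_+^{M-2}$. Let $Y$ be a continuous time Markov process on $\mathcal S\cup\{D\}$ with transition intensity matrix $\Theta=\Theta(\underline k,\underline\lambda)$, in the sense that (writing $i_{M+1}=D$) $\lim_{h\to0}\frac1h\mathbb P(Y_h=i_n\mid Y_0=i_j)=\Theta_{jn}$ for $j\ne n$ in $\{1,\dots,M+1\}$ and $\lim_{h\to0}\frac1h(\mathbb P(Y_h=i_j\mid Y_0=i_j)-1)=\Theta_{jj}$ for $j\in\{1,\dots,M+1\}$. Let $a:\mathcal S\to\mathbb R_+$ be given by $a(i_j)=\lambda_j(i_{j+1}-i_j)(i_j-i_{j-1})$ for $j=2,\dots,M-1$ and $a(i_1)=a(i_M)=0$. Then $Y$ has infinitesimal generator $$a\Big(\frac12\Delta+b\nabla-k\Big).$$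
   Context: Conventions: $\mathbb R_+=[0,\infty)$, $M\ge3$. $D$ is an absorbing cemetery state (index $M+1$); functions $f$ on $\mathcal S$ are extended by $f(D)=0$, and $b(i_j)=b_j$, $k(i_j)=k_j$ for $2\le j\le M-1$. Set $\widetilde k_j=(i_{j+1}-i_j)(i_j-i_{j-1})k_j$ for $2\le j\le M-1$; for $2\le j\le M-1$, $q_{j,j+1}=\frac{i_j-i_{j-1}}{i_{j+1}-i_{j-1}}(1+(i_{j+1}-i_j)b_j)$, $q_{j,j-1}=\frac{i_{j+1}-i_j}{i_{j+1}-i_{j-1}}(1-(i_j-i_{j-1})b_j)$. $\Theta$ is the $(M+1)\times(M+1)$ matrix whose rows $1$, $M$, $M+1$ are zero and, for $2\le j\le M-1$, $\Theta_{j,j+1}=\lambda_jq_{j,j+1}$, $\Theta_{j,j-1}=\lambda_jq_{j,j-1}$ (neighbours in $\{1,\dots,M\}$), $\Theta_{jj}=-\lambda_j(1+\widetilde k_j)$, $\Theta_{j,M+1}=\lambda_j\widetilde k_j$, all other entries $0$. Discrete operators on $f:\mathcal S\to\mathbb R$: $\Delta f(i_1)=\Delta f(i_M)=\nabla f(i_1)=\nabla f(i_M)=0$ and, for $2\le j\le M-1$, $\Delta f(i_j)=\frac{2}{(i_{j+1}-i_j)(i_j-i_{j-1})}\Big(\frac{i_j-i_{j-1}}{i_{j+1}-i_{j-1}}f(i_{j+1})-f(i_j)+\frac{i_{j+1}-i_j}{i_{j+1}-i_{j-1}}f(i_{j-1})\Big)$, $\nabla f(i_j)=\frac{f(i_{j+1})-f(i_{j-1})}{i_{j+1}-i_{j-1}}$.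 The statement that $Y$ has generator $\mathcal L$ means that $F(t,i_j)=\mathbb E[f(Y_t)\mid Y_0=i_j]$ satisfies $\frac{\partial}{\partial t}F(t,i_j)=\mathcal LF(t,i_j)$ for $j=1,\dots,M$ and every $f:\mathcal S\to\mathbb R$. *)

theory Defs
  imports "HOL-Probability.Probability"
begin

section \<open>Finite-state Markov processes in continuous time\<close>

text \<open>
  A time-homogeneous Markov process on the finite state space \<open>E\<close> with time set \<open>[0,\<infinity>)\<close>.
  The measure \<open>P x\<close> is the law conditional on \<open>Y\<^sub>0 = x\<close>, for every starting point \<open>x\<close>
  (the usual family of laws, so that conditioning on \<open>Y\<^sub>0 = x\<close> makes sense for every state).
  The Markov property is stated with respect to the natural filtration of \<open>Y\<close>.
  No path regularity is required.
\<close>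

definition natural_filtration :: "'w set \<Rightarrow> 's set \<Rightarrow> (real \<Rightarrow> 'w \<Rightarrow> 's) \<Rightarrow> real \<Rightarrow> 'w measure" where
  "natural_filtration \<Omega> E Y s = sigma \<Omega> {Y u -` {y} \<inter> \<Omega> | u y. 0 \<le> u \<and> u \<le> s \<and> y \<in> E}"

locale markov_process =
  fixes E :: "'s set" and P :: "'s \<Rightarrow> 'w measure" and Y :: "real \<Rightarrow> 'w \<Rightarrow> 's"
  assumes finite_states: "finite E"
    and prob_space_law: "\<And>x. x \<in> E \<Longrightarrow> prob_space (P x)"
    and sets_law: "\<And>x y. x \<in> E \<Longrightarrow> y \<in> E \<Longrightarrow> sets (P x) = sets (P y)"
    and random_variable: "\<And>x t. x \<in> E \<Longrightarrow> 0 \<le> t \<Longrightarrow> Y t \<in> measurable (P x) (count_space E)"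
    and start: "\<And>x. x \<in> E \<Longrightarrow> AE \<omega> in P x. Y 0 \<omega> = x"
    and markov_property: "\<And>x y s t. x \<in> E \<Longrightarrow> y \<in> E \<Longrightarrow> 0 \<le> s \<Longrightarrow> 0 \<le> t \<Longrightarrow>
      AE \<omega> in P x.
        real_cond_exp (P x) (natural_filtration (space (P x)) E Y s)
          (indicat_real {\<omega>' \<in> space (P x). Y (s + t) \<omega>' = y}) \<omega>
        = \<P>(\<omega>' in P (Y s \<omega>). Y t \<omega>' = y)"

definition has_intensity_matrix ::
  "('s \<Rightarrow> 'w measure) \<Rightarrow> (real \<Rightarrow> 'w \<Rightarrow> 's) \<Rightarrow> nat \<Rightarrow> (nat \<Rightarrow> 's) \<Rightarrow> (nat \<Rightarrow> nat \<Rightarrow> real) \<Rightarrow> bool" where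
  "has_intensity_matrix P Y N st \<Theta> \<longleftrightarrow>
     (\<forall>j\<in>{1..N}. \<forall>n\<in>{1..N}. j \<noteq> n \<longrightarrow>
        ((\<lambda>h. 1 / h * \<P>(\<omega> in P (st j). Y h \<omega> = st n)) \<longlongrightarrow> \<Theta> j n) (at_right 0)) \<and>
     (\<forall>j\<in>{1..N}.
        ((\<lambda>h. 1 / h * (\<P>(\<omega> in P (st j). Y h \<omega> = st j) - 1)) \<longlongrightarrow> \<Theta> j j) (at_right 0))"


section \<open>Grid with a cemetery state\<close>

text \<open>
  The grid is \<open>\<S> = {i 1, \<dots>, i M}\<close>; the state space is a subset of \<^typ>\<open>real option\<close>, where
  \<^term>\<open>None\<close> is the cemetery \<open>D\<close> and has index \<open>M + 1\<close>.
\<close>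

definition grid :: "nat \<Rightarrow> (nat \<Rightarrow> real) \<Rightarrow> real set" where
  "grid M i = i ` {1..M}"

definition state_of :: "nat \<Rightarrow> (nat \<Rightarrow> real) \<Rightarrow> nat \<Rightarrow> real option" where
  "state_of M i j = (if j = M + 1 then None else Some (i j))"

definition states :: "nat \<Rightarrow> (nat \<Rightarrow> real) \<Rightarrow> real option set" where
  "states M i = insert None (Some ` grid M i)"

text \<open>The extension of a function on the grid by \<open>f(D) = 0\<close>.\<close>

definition extend :: "(real \<Rightarrow> real) \<Rightarrow> real option \<Rightarrow> real" where
  "extend f z = (case z of None \<Rightarrow> 0 | Some x \<Rightarrow> f x)"

definition k_tilde :: "(nat \<Rightarrow> real) \<Rightarrow> (nat \<Rightarrow> real) \<Rightarrow> nat \<Rightarrow> real" where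
  "k_tilde i k j = (i (j + 1) - i j) * (i j - i (j - 1)) * k j"

definition q_up :: "(nat \<Rightarrow> real) \<Rightarrow> (nat \<Rightarrow> real) \<Rightarrow> nat \<Rightarrow> real" where
  "q_up i b j = (i j - i (j - 1)) / (i (j + 1) - i (j - 1)) * (1 + (i (j + 1) - i j) * b j)"

definition q_down :: "(nat \<Rightarrow> real) \<Rightarrow> (nat \<Rightarrow> real) \<Rightarrow> nat \<Rightarrow> real" where
  "q_down i b j = (i (j + 1) - i j) / (i (j + 1) - i (j - 1)) * (1 - (i j - i (j - 1)) * b j)"

definition Theta ::
  "nat \<Rightarrow> (nat \<Rightarrow> real) \<Rightarrow> (nat \<Rightarrow> real) \<Rightarrow> (nat \<Rightarrow> real) \<Rightarrow> (nat \<Rightarrow> real) \<Rightarrow> nat \<Rightarrow> nat \<Rightarrow> real" where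
  "Theta M i b k lam j n =
     (if j \<in> {2..M - 1} then
        if n = j + 1 then lam j * q_up i b j
        else if n = j - 1 then lam j * q_down i b j
        else if n = j then - lam j * (1 + k_tilde i k j)
        else if n = M + 1 then lam j * k_tilde i k j
        else 0
      else 0)"


section \<open>Discrete operators and generators\<close>

text \<open>
  The function on the grid with \<open>i j \<mapsto> v j\<close>; its values off the grid are irrelevant.
\<close>

definition grid_fun :: "nat \<Rightarrow> (nat \<Rightarrow> real) \<Rightarrow> (nat \<Rightarrow> real) \<Rightarrow> real \<Rightarrow> real" where
  "grid_fun M i v x = v (the_inv_into {1..M} i x)"

definition discrete_laplacian :: "nat \<Rightarrow> (nat \<Rightarrow> real) \<Rightarrow> (real \<Rightarrow> real) \<Rightarrow> real \<Rightarrow> real" where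
  "discrete_laplacian M i f = grid_fun M i (\<lambda>j.
     if j \<in> {2..M - 1} then
       2 / ((i (j + 1) - i j) * (i j - i (j - 1))) *
         ((i j - i (j - 1)) / (i (j + 1) - i (j - 1)) * f (i (j + 1)) - f (i j)
          + (i (j + 1) - i j) / (i (j + 1) - i (j - 1)) * f (i (j - 1)))
     else 0)"

definition discrete_gradient :: "nat \<Rightarrow> (nat \<Rightarrow> real) \<Rightarrow> (real \<Rightarrow> real) \<Rightarrow> real \<Rightarrow> real" where
  "discrete_gradient M i f = grid_fun M i (\<lambda>j.
     if j \<in> {2..M - 1} then (f (i (j + 1)) - f (i (j - 1))) / (i (j + 1) - i (j - 1)) else 0)"

definition mean_value ::
  "(real option \<Rightarrow> 'w measure) \<Rightarrow> (real \<Rightarrow> 'w \<Rightarrow> real option) \<Rightarrow> (real \<Rightarrow> real) \<Rightarrow> real \<Rightarrow> real \<Rightarrow> real" where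
  "mean_value P Y f t x = (\<integral>\<omega>. extend f (Y t \<omega>) \<partial>P (Some x))"

text \<open>
  The derivative is taken within \<open>[0,\<infinity>)\<close>, so it is one-sided at time \<open>0\<close>.
\<close>

definition has_generator ::
  "real set \<Rightarrow> (real option \<Rightarrow> 'w measure) \<Rightarrow> (real \<Rightarrow> 'w \<Rightarrow> real option) \<Rightarrow>
   ((real \<Rightarrow> real) \<Rightarrow> real \<Rightarrow> real) \<Rightarrow> bool" where
  "has_generator S P Y L \<longleftrightarrow>
     (\<forall>f :: real \<Rightarrow> real. \<forall>t\<ge>0. \<forall>x\<in>S.
        ((\<lambda>s. mean_value P Y f s x) has_real_derivative L (mean_value P Y f t) x)
          (at t within {0..}))"

end

theory Submission
  imports Defs
begin

text \<open>
  The Markov property gives the Chapman--Kolmogorov equations for the transition function, hence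
  \<open>F(s + t, \<cdot>) = p\<^sub>s F(t, \<cdot>)\<close>. Dividing \<open>F(t + h, \<cdot>) - F(t, \<cdot>) = (p\<^sub>h - 1) F(t, \<cdot>)\<close> by \<open>h\<close> yields
  the right derivative at \<open>t\<close>; the left derivative uses \<open>F(t, \<cdot>) - F(t - h, \<cdot>) = (p\<^sub>h - 1) F(t - h, \<cdot>)\<close>
  together with left continuity of \<open>F\<close>, which follows from boundedness of \<open>F\<close> and \<open>p\<^sub>h \<rightarrow> 1\<close>.
  So the generator is \<open>\<Theta>\<close> acting on functions on \<open>\<S> \<union> {D}\<close>. Since row \<open>M + 1\<close> of \<open>\<Theta>\<close> vanishes,
  the inequality \<open>1 - p\<^sub>n\<^sub>h(D, D) \<le> n (1 - p\<^sub>h(D, D))\<close> with \<open>h = t / n \<rightarrow> 0\<close> shows that \<open>D\<close> is absorbing, so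
  \<open>F(t, D) = f(D) = 0\<close> and only the part of \<open>\<Theta>\<close> on \<open>\<S>\<close> matters.
\<close>

context markov_process
begin

abbreviation transition :: "'s \<Rightarrow> real \<Rightarrow> 's \<Rightarrow> real" where
  "transition x t y \<equiv> \<P>(\<omega> in P x. Y t \<omega> = y)"

lemma event_measurable:
  assumes "x \<in> E" "0 \<le> t"
  shows "{\<omega> \<in> space (P x). Y t \<omega> = y} \<in> sets (P x)"
proof (cases "y \<in> E")
  case True
  have "Y t -` {y} \<inter> space (P x) \<in> sets (P x)"
    using random_variable[OF assms] True by (auto intro: measurable_sets)
  then show ?thesis by (simp add: vimage_def Int_def conj_commute)
next
  case False
  then have empty: "{\<omega> \<in> space (P x). Y t \<omega> = y} = {}"
    using measurable_space[OF random_variable[OF assms]] by auto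
  show ?thesis unfolding empty by simp
qed

lemma expectation_eq_sum:
  fixes g :: "'s \<Rightarrow> real"
  assumes x: "x \<in> E" and t: "0 \<le> t"
  shows "(\<integral>\<omega>. g (Y t \<omega>) \<partial>P x) = (\<Sum>y\<in>E. transition x t y * g y)"
proof -
  interpret prob_space "P x" by (rule prob_space_law[OF x])
  have "(\<integral>\<omega>. g (Y t \<omega>) \<partial>P x)
      = (\<integral>\<omega>. (\<Sum>y\<in>E. indicat_real {\<omega> \<in> space (P x). Y t \<omega> = y} \<omega> * g y) \<partial>P x)"
  proof (rule Bochner_Integration.integral_cong[OF refl])
    fix \<omega> assume w: "\<omega> \<in> space (P x)"
    have "Y t \<omega> \<in> E" using measurable_space[OF random_variable[OF x t] w] by simp
    then have "(\<Sum>y\<in>E. if Y t \<omega> = y then g y else 0) = g (Y t \<omega>)"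
      using finite_states by (simp add: sum.delta')
    moreover have "indicat_real {\<omega> \<in> space (P x). Y t \<omega> = y} \<omega> * g y = (if Y t \<omega> = y then g y else 0)" for y
      using w by simp
    ultimately show "g (Y t \<omega>) = (\<Sum>y\<in>E. indicat_real {\<omega> \<in> space (P x). Y t \<omega> = y} \<omega> * g y)"
      by simp
  qed
  also have "\<dots> = (\<Sum>y\<in>E. \<integral>\<omega>. indicat_real {\<omega> \<in> space (P x). Y t \<omega> = y} \<omega> * g y \<partial>P x)"
    by (intro Bochner_Integration.integral_sum integrable_mult_left integrable_real_indicator
        event_measurable[OF x t]) (simp add: emeasure_eq_measure)
  also have "\<dots> = (\<Sum>y\<in>E. transition x t y * g y)"
    using event_measurable[OF x t] by simp
  finally show ?thesis .
qed

lemma transition_start: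
  assumes "x \<in> E"
  shows "transition x 0 y = of_bool (x = y)"
proof -
  interpret prob_space "P x" by (rule prob_space_law[OF assms])
  have "transition x 0 y = prob {\<omega> \<in> space (P x). x = y}"
  proof (rule finite_measure_eq_AE)
    show "AE \<omega> in P x. (\<omega> \<in> {\<omega> \<in> space (P x). Y 0 \<omega> = y}) = (\<omega> \<in> {\<omega> \<in> space (P x). x = y})"
      using start[OF assms] by eventually_elim simp
  qed (simp_all add: event_measurable[OF assms])
  then show ?thesis using prob_space by auto
qed

lemma subalgebra_natural_filtration:
  assumes "x \<in> E"
  shows "subalgebra (P x) (natural_filtration (space (P x)) E Y s)"
proof -
  have "{Y u -` {y} \<inter> space (P x) | u y. 0 \<le> u \<and> u \<le> s \<and> y \<in> E} \<subseteq> sets (P x)"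
    using random_variable[OF assms] by (auto intro!: measurable_sets)
  then show ?thesis
    by (auto simp: subalgebra_def natural_filtration_def space_measure_of_conv sets_measure_of_conv
        dest: sets.sigma_sets_subset)
qed

lemma Chapman_Kolmogorov:
  assumes x: "x \<in> E" and y: "y \<in> E" and s: "0 \<le> s" and t: "0 \<le> t"
  shows "transition x (s + t) y = (\<Sum>z\<in>E. transition x s z * transition z t y)"
proof -
  interpret prob_space "P x" by (rule prob_space_law[OF x])
  let ?F = "natural_filtration (space (P x)) E Y s"
  interpret finite_measure_subalgebra "P x" ?F
    by unfold_locales (rule subalgebra_natural_filtration[OF x])
  let ?A = "{\<omega> \<in> space (P x). Y (s + t) \<omega> = y}"
  have st: "0 \<le> s + t" using s t by simp
  have A: "?A \<in> sets (P x)" using event_measurable[OF x st] .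
  have "transition x (s + t) y = (\<integral>\<omega>. indicat_real ?A \<omega> \<partial>P x)"
    using A by simp
  also have "\<dots> = (\<integral>\<omega>. real_cond_exp (P x) ?F (indicat_real ?A) \<omega> \<partial>P x)"
    by (rule real_cond_exp_int(2)[symmetric])
      (auto intro!: integrable_real_indicator A simp: emeasure_eq_measure)
  also have "\<dots> = (\<integral>\<omega>. transition (Y s \<omega>) t y \<partial>P x)"
  proof (rule integral_cong_AE)
    show "(\<lambda>\<omega>. transition (Y s \<omega>) t y) \<in> borel_measurable (P x)"
      by (rule measurable_compose[OF random_variable[OF x s]]) simp
  qed (use markov_property[OF x y s t] in auto)
  also have "\<dots> = (\<Sum>z\<in>E. transition x s z * transition z t y)"
    by (rule expectation_eq_sum[OF x s])
  finally show ?thesis .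
qed

lemma expectation_add:
  fixes g :: "'s \<Rightarrow> real"
  assumes x: "x \<in> E" and s: "0 \<le> s" and t: "0 \<le> t"
  shows "(\<integral>\<omega>. g (Y (s + t) \<omega>) \<partial>P x) = (\<Sum>z\<in>E. transition x s z * (\<integral>\<omega>. g (Y t \<omega>) \<partial>P z))"
proof -
  have "(\<integral>\<omega>. g (Y (s + t) \<omega>) \<partial>P x) = (\<Sum>y\<in>E. transition x (s + t) y * g y)"
    using s t by (intro expectation_eq_sum[OF x]) simp
  also have "\<dots> = (\<Sum>y\<in>E. \<Sum>z\<in>E. transition x s z * (transition z t y * g y))"
    by (simp add: Chapman_Kolmogorov[OF x _ s t] sum_distrib_right mult.assoc)
  also have "\<dots> = (\<Sum>z\<in>E. transition x s z * (\<Sum>y\<in>E. transition z t y * g y))"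
    by (subst sum.swap) (simp add: sum_distrib_left)
  also have "\<dots> = (\<Sum>z\<in>E. transition x s z * (\<integral>\<omega>. g (Y t \<omega>) \<partial>P z))"
    by (simp add: expectation_eq_sum[OF _ t])
  finally show ?thesis .
qed

lemma expectation_bounded:
  fixes g :: "'s \<Rightarrow> real"
  assumes x: "x \<in> E" and t: "0 \<le> t"
  shows "\<bar>\<integral>\<omega>. g (Y t \<omega>) \<partial>P x\<bar> \<le> (\<Sum>y\<in>E. \<bar>g y\<bar>)"
proof -
  interpret prob_space "P x" by (rule prob_space_law[OF x])
  have "\<bar>\<Sum>y\<in>E. transition x t y * g y\<bar> \<le> (\<Sum>y\<in>E. \<bar>transition x t y * g y\<bar>)"
    by (rule sum_abs)
  also have "\<dots> \<le> (\<Sum>y\<in>E. \<bar>g y\<bar>)"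
    by (intro sum_mono) (simp add: abs_mult mult_left_le_one_le)
  finally show ?thesis by (simp add: expectation_eq_sum[OF x t])
qed

lemma expectation_increment:
  fixes g :: "'s \<Rightarrow> real"
  assumes x: "x \<in> E" and h: "0 \<le> h" and t: "0 \<le> t"
  shows "(\<integral>\<omega>. g (Y (h + t) \<omega>) \<partial>P x) - (\<integral>\<omega>. g (Y t \<omega>) \<partial>P x)
    = (\<Sum>z\<in>E. (transition x h z - of_bool (x = z)) * (\<integral>\<omega>. g (Y t \<omega>) \<partial>P z))"
  unfolding expectation_add[OF x h t]
  using x finite_states
  by (simp add: left_diff_distrib sum_subtractf of_bool_def if_distrib[of "\<lambda>c. c * _"]
      sum.delta' cong: if_cong)

lemma backward_equation:
  fixes g :: "'s \<Rightarrow> real" and Q :: "'s \<Rightarrow> 's \<Rightarrow> real"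
  assumes Q: "\<And>x y. x \<in> E \<Longrightarrow> y \<in> E \<Longrightarrow>
      ((\<lambda>h. (transition x h y - of_bool (x = y)) / h) \<longlongrightarrow> Q x y) (at_right 0)"
    and x: "x \<in> E" and t: "0 \<le> t"
  shows "((\<lambda>s. \<integral>\<omega>. g (Y s \<omega>) \<partial>P x) has_real_derivative (\<Sum>z\<in>E. Q x z * (\<integral>\<omega>. g (Y t \<omega>) \<partial>P z)))
    (at t within {0..})"
proof -
  define F where "F s z = (\<integral>\<omega>. g (Y s \<omega>) \<partial>P z)" for s z
  define d where "d h y z = transition y h z - of_bool (y = z)" for h y z
  define C where "C = (\<Sum>y\<in>E. \<bar>g y\<bar>)"
  define L where "L = (\<Sum>z\<in>E. Q x z * F t z)"
  have Q': "((\<lambda>h. d h y z / h) \<longlongrightarrow> Q y z) (at_right 0)" if "y \<in> E" "z \<in> E" for y z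
    using Q[OF that] by (simp add: d_def)
  have d0: "((\<lambda>h. d h y z) \<longlongrightarrow> 0) (at_right 0)" if "y \<in> E" "z \<in> E" for y z
  proof -
    have "((\<lambda>h. d h y z / h * h) \<longlongrightarrow> Q y z * 0) (at_right 0)"
      by (intro tendsto_mult Q'[OF that] tendsto_ident_at)
    then show ?thesis
      by (rule tendsto_eq_rhs[OF Lim_transform_eventually])
        (auto simp: eventually_at_right_field intro!: exI[of _ 1])
  qed
  have incr: "F (h + s) y - F s y = (\<Sum>z\<in>E. d h y z * F s z)" if "y \<in> E" "0 \<le> h" "0 \<le> s" for y h s
    unfolding F_def d_def by (rule expectation_increment[OF that])
  have bound: "\<bar>F s y\<bar> \<le> C" if "y \<in> E" "0 \<le> s" for y s
    unfolding F_def C_def by (rule expectation_bounded[OF that])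
  have right: "((\<lambda>s. (F s x - F t x) / (s - t)) \<longlongrightarrow> L) (at_right t)"
  proof -
    have "((\<lambda>h. \<Sum>z\<in>E. d h x z / h * F t z) \<longlongrightarrow> L) (at_right 0)"
      unfolding L_def by (intro tendsto_sum tendsto_mult tendsto_const Q' x)
    then have "((\<lambda>h. (F (h + t) x - F t x) / (h + t - t)) \<longlongrightarrow> L) (at_right 0)"
    proof (rule Lim_transform_eventually)
      show "\<forall>\<^sub>F h in at_right 0. (\<Sum>z\<in>E. d h x z / h * F t z) = (F (h + t) x - F t x) / (h + t - t)"
        using eventually_at_right_less[of 0]
        by eventually_elim (simp add: incr[OF x _ t] sum_divide_distrib)
    qed
    then show ?thesis
      by (subst at_right_to_0) (simp add: filterlim_filtermap)
  qed
  have left: "((\<lambda>s. (F s x - F t x) / (s - t)) \<longlongrightarrow> L) (at_left t)" if t: "0 < t"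
  proof -
    have small: "\<forall>\<^sub>F h in at_right 0. 0 < h \<and> h < t"
      using t by (auto simp: eventually_at_right_field)
    have cont: "((\<lambda>h. F (t - h) y) \<longlongrightarrow> F t y) (at_right 0)" if y: "y \<in> E" for y
    proof -
      have "((\<lambda>h. \<Sum>z\<in>E. \<bar>d h y z\<bar> * C) \<longlongrightarrow> (\<Sum>z\<in>E. \<bar>0\<bar> * C)) (at_right 0)"
        by (intro tendsto_sum tendsto_mult tendsto_const tendsto_rabs d0 y)
      then have lim: "((\<lambda>h. \<Sum>z\<in>E. \<bar>d h y z\<bar> * C) \<longlongrightarrow> 0) (at_right 0)" by simp
      have "((\<lambda>h. F (t - h) y - F t y) \<longlongrightarrow> 0) (at_right 0)"
      proof (rule Lim_null_comparison[OF _ lim])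
        show "\<forall>\<^sub>F h in at_right 0. norm (F (t - h) y - F t y) \<le> (\<Sum>z\<in>E. \<bar>d h y z\<bar> * C)"
          using small
        proof eventually_elim
          case (elim h)
          have "norm (F (t - h) y - F t y) = \<bar>\<Sum>z\<in>E. d h y z * F (t - h) z\<bar>"
            using incr[OF y, of h "t - h"] elim by (simp add: abs_minus_commute)
          also have "\<dots> \<le> (\<Sum>z\<in>E. \<bar>d h y z * F (t - h) z\<bar>)" by (rule sum_abs)
          also have "\<dots> \<le> (\<Sum>z\<in>E. \<bar>d h y z\<bar> * C)"
            using elim by (intro sum_mono) (auto simp: abs_mult intro!: mult_left_mono bound)
          finally show ?case .
        qed
      qed
      then show ?thesis by (rule LIM_zero_cancel)
    qed
    have "((\<lambda>h. \<Sum>z\<in>E. d h x z / h * F (t - h) z) \<longlongrightarrow> L) (at_right 0)"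
      unfolding L_def by (intro tendsto_sum tendsto_mult cont Q' x)
    then have "((\<lambda>h. (F (t - h) x - F t x) / (t - h - t)) \<longlongrightarrow> L) (at_right 0)"
    proof (rule Lim_transform_eventually)
      show "\<forall>\<^sub>F h in at_right 0.
          (\<Sum>z\<in>E. d h x z / h * F (t - h) z) = (F (t - h) x - F t x) / (t - h - t)"
        using small
      proof eventually_elim
        case (elim h)
        have "(F (t - h) x - F t x) / (t - h - t) = (F t x - F (t - h) x) / h"
          using elim by (simp add: field_simps)
        then show ?case
          using incr[OF x, of h "t - h"] elim by (simp add: sum_divide_distrib)
      qed
    qed
    then show ?thesis
      by (simp add: at_left_minus[of t] at_right_to_0[of "- t"] filterlim_filtermap)
  qed
  have "((\<lambda>s. (F s x - F t x) / (s - t)) \<longlongrightarrow> L) (at t within {0..})"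
  proof (cases "t = 0")
    case True
    then show ?thesis using right by (simp add: at_within_Ici_at_right)
  next
    case False
    then have "0 < t" using t by simp
    then have "((\<lambda>s. (F s x - F t x) / (s - t)) \<longlongrightarrow> L) (at t)"
      using left right by (simp add: filterlim_split_at)
    then show ?thesis by (rule tendsto_within_subset) simp
  qed
  then show ?thesis
    unfolding has_field_derivative_iff F_def L_def .
qed

lemma absorbing:
  assumes x: "x \<in> E" and t: "0 \<le> t"
    and Q: "((\<lambda>h. (transition x h x - 1) / h) \<longlongrightarrow> 0) (at_right 0)"
  shows "transition x t x = 1"
proof (cases "t = 0")
  case True
  then show ?thesis by (simp add: transition_start[OF x])
next
  case False
  then have t: "0 < t" using t by simp
  interpret prob_space "P x" by (rule prob_space_law[OF x])
  let ?p = "\<lambda>t. transition x t x"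
  have super: "?p s * ?p h \<le> ?p (s + h)" if "0 \<le> s" "0 \<le> h" for s h
    unfolding Chapman_Kolmogorov[OF x x that]
    using x finite_states
    by (intro member_le_sum[of x E "\<lambda>z. transition x s z * transition z h x"]) auto
  have lower: "1 - ?p (real n * h) \<le> real n * (1 - ?p h)" if h: "0 \<le> h" for n h
  proof (induction n)
    case 0
    then show ?case by (simp add: transition_start[OF x])
  next
    case (Suc n)
    have "0 \<le> (1 - ?p (real n * h)) * (1 - ?p h)" by (intro mult_nonneg_nonneg) auto
    then have "1 - ?p (real n * h) * ?p h \<le> (1 - ?p (real n * h)) + (1 - ?p h)"
      by (simp add: algebra_simps)
    moreover have "?p (real n * h) * ?p h \<le> ?p (real (Suc n) * h)"
      using super[of "real n * h" h] h by (simp add: algebra_simps)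
    ultimately show ?case using Suc by (simp add: algebra_simps)
  qed
  have lim: "(\<lambda>n. t / real (Suc n)) \<longlonglongrightarrow> 0"
    by real_asymp
  have "filterlim (\<lambda>n. t / real (Suc n)) (at_right 0) sequentially"
    using lim t by (auto simp: filterlim_at)
  from filterlim_compose[OF Q this]
  have "(\<lambda>n. - t * ((?p (t / real (Suc n)) - 1) / (t / real (Suc n)))) \<longlonglongrightarrow> - t * 0"
    by (intro tendsto_mult tendsto_const)
  then have "1 - ?p t \<le> - t * 0"
  proof (rule LIMSEQ_le_const, intro exI allI impI)
    fix n :: nat
    have "1 - ?p t \<le> real (Suc n) * (1 - ?p (t / real (Suc n)))"
      using lower[of "t / real (Suc n)" "Suc n"] t by (simp del: of_nat_Suc)
    also have "\<dots> = - t * ((?p (t / real (Suc n)) - 1) / (t / real (Suc n)))"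
      using t by (simp add: field_simps del: of_nat_Suc)
    finally show "1 - ?p t \<le> - t * ((?p (t / real (Suc n)) - 1) / (t / real (Suc n)))" .
  qed
  then show ?thesis using prob_le_1[of "{\<omega> \<in> space (P x). Y t \<omega> = x}"] by linarith
qed

lemma expectation_absorbing:
  fixes g :: "'s \<Rightarrow> real"
  assumes x: "x \<in> E" and t: "0 \<le> t"
    and Q: "((\<lambda>h. (transition x h x - 1) / h) \<longlongrightarrow> 0) (at_right 0)"
  shows "(\<integral>\<omega>. g (Y t \<omega>) \<partial>P x) = g x"
proof -
  interpret prob_space "P x" by (rule prob_space_law[OF x])
  have "AE \<omega> in P x. Y t \<omega> = x"
    using absorbing[OF assms] event_measurable[OF x t, of x] by (simp add: prob_Collect_eq_1)
  then have "(\<integral>\<omega>. g (Y t \<omega>) \<partial>P x) = (\<integral>\<omega>. g x \<partial>P x)"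
    by (intro integral_cong_AE measurable_compose[OF random_variable[OF x t]]) auto
  then show ?thesis by (simp add: prob_space)
qed

end

lemma Theta_eq_generator:
  fixes i b k lam F :: "nat \<Rightarrow> real"
  assumes j: "j \<in> {2..M - 1}" and F: "F (M + 1) = 0"
    and i: "i (j - 1) < i j" "i j < i (j + 1)"
  shows "(\<Sum>n=1..M + 1. Theta M i b k lam j n * F n) =
    lam j * (i (j + 1) - i j) * (i j - i (j - 1)) *
      (1 / 2 * (2 / ((i (j + 1) - i j) * (i j - i (j - 1))) *
         ((i j - i (j - 1)) / (i (j + 1) - i (j - 1)) * F (j + 1) - F j
          + (i (j + 1) - i j) / (i (j + 1) - i (j - 1)) * F (j - 1)))
       + b j * ((F (j + 1) - F (j - 1)) / (i (j + 1) - i (j - 1))) - k j * F j)"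
proof -
  let ?Th = "Theta M i b k lam j"
  define u d where "u = i (j + 1) - i j" and "d = i j - i (j - 1)"
  have ud: "u > 0" "d > 0" "i (j + 1) - i (j - 1) = u + d"
    using i by (auto simp: u_def d_def)
  have "(\<Sum>n=1..M + 1. Theta M i b k lam j n * F n)
      = (\<Sum>n\<in>{j - 1, j, j + 1}. Theta M i b k lam j n * F n)"
    using j F by (intro sum.mono_neutral_right) (auto simp: Theta_def)
  also have "\<dots> = lam j * (d / (u + d) * (1 + u * b j)) * F (j + 1)
      + lam j * (u / (u + d) * (1 - d * b j)) * F (j - 1) - lam j * (1 + u * d * k j) * F j"
  proof -
    have neq: "j - 1 \<noteq> j" "j - 1 \<noteq> j + 1" using j by auto
    have up: "?Th (j + 1) = lam j * (d / (u + d) * (1 + u * b j))"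
      and down: "?Th (j - 1) = lam j * (u / (u + d) * (1 - d * b j))"
      and diag: "?Th j = - lam j * (1 + u * d * k j)"
      using j by (auto simp: Theta_def q_up_def q_down_def k_tilde_def u_def d_def)
    have "(\<Sum>n\<in>{j - 1, j, j + 1}. ?Th n * F n)
        = ?Th (j - 1) * F (j - 1) + ?Th j * F j + ?Th (j + 1) * F (j + 1)"
      using neq by simp
    then show ?thesis unfolding up down diag by simp
  qed
  also have "\<dots> = lam j * u * d * (1 / 2 * (2 / (u * d) *
         (d / (u + d) * F (j + 1) - F j + u / (u + d) * F (j - 1)))
       + b j * ((F (j + 1) - F (j - 1)) / (u + d)) - k j * F j)"
    using ud(1,2) add_pos_pos[OF ud(1,2)] by (simp add: divide_simps) (simp add: algebra_simps)
  finally show ?thesis by (simp only: ud(3) flip: u_def d_def)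
qed

theorem lemma2p5:
  fixes M :: nat
    and i b k lam :: "nat \<Rightarrow> real"
    and a bfun kfun :: "real \<Rightarrow> real"
    and P :: "real option \<Rightarrow> 'w measure"
    and Y :: "real \<Rightarrow> 'w \<Rightarrow> real option"
  assumes "M \<ge> 3"
    and "strict_mono_on {1..M} i"
    and "\<And>j. j \<in> {2..M - 1} \<Longrightarrow> - 1 / (i (j + 1) - i j) < b j \<and> b j < 1 / (i j - i (j - 1))"
    and "\<And>j. j \<in> {2..M - 1} \<Longrightarrow> k j \<ge> 0"
    and "\<And>j. j \<in> {2..M - 1} \<Longrightarrow> lam j \<ge> 0"
    and "markov_process (states M i) P Y"
    and "has_intensity_matrix P Y (M + 1) (state_of M i) (Theta M i b k lam)"
    and "\<And>j. j \<in> {2..M - 1} \<Longrightarrow> a (i j) = lam j * (i (j + 1) - i j) * (i j - i (j - 1))"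
    and "a (i 1) = 0" and "a (i M) = 0"
    and "\<And>j. j \<in> {2..M - 1} \<Longrightarrow> bfun (i j) = b j"
    and "\<And>j. j \<in> {2..M - 1} \<Longrightarrow> kfun (i j) = k j"
  shows "has_generator (grid M i) P Y
    (\<lambda>f x. a x * (1 / 2 * discrete_laplacian M i f x + bfun x * discrete_gradient M i f x - kfun x * f x))"
proof -
  interpret markov_process "states M i" P Y by fact
  let ?st = "state_of M i" and ?Th = "Theta M i b k lam"
  have inj: "inj_on i {1..M}"
    using assms(2) by (rule strict_mono_on_imp_inj_on)
  have bij: "bij_betw ?st {1..M + 1} (states M i)"
  proof (rule bij_betw_imageI)
    have "m = n" if "m \<in> {1..M + 1}" "n \<in> {1..M + 1}" "?st m = ?st n" for m n
      using that inj_onD[OF inj, of m n] by (simp add: state_of_def split: if_splits)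
    then show "inj_on ?st {1..M + 1}" by (rule inj_onI)
    have "?st ` {1..M} = Some ` i ` {1..M}"
      unfolding image_image by (rule image_cong) (simp_all add: state_of_def)
    moreover have "{1..M + 1} = insert (M + 1) {1..M}" by auto
    ultimately show "?st ` {1..M + 1} = states M i"
      by (simp only: image_insert states_def grid_def) (simp add: state_of_def)
  qed
  define idx where "idx = the_inv_into {1..M + 1} ?st"
  have idx: "idx (?st n) = n" if "n \<in> {1..M + 1}" for n
    unfolding idx_def using bij that by (intro the_inv_into_f_f) (auto simp: bij_betw_def)
  have idx': "idx z \<in> {1..M + 1}" "?st (idx z) = z" if "z \<in> states M i" for z
    using that idx unfolding bij_betw_imp_surj_on[OF bij, symmetric] by (auto simp del: atLeastAtMost_iff)
  have st: "?st n \<in> states M i" if "n \<in> {1..M + 1}" for n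
    using bij that by (rule bij_betwE[rule_format])
  have st_Some: "?st n = Some (i n)" if "n \<in> {1..M}" for n
    using that by (auto simp: state_of_def)
  have intensity: "((\<lambda>h. (transition (?st m) h (?st n) - of_bool (m = n)) / h) \<longlongrightarrow> ?Th m n) (at_right 0)"
    if "m \<in> {1..M + 1}" "n \<in> {1..M + 1}" for m n
    using assms(7) that by (cases "m = n") (auto simp: has_intensity_matrix_def)
  have Q: "((\<lambda>h. (transition x h y - of_bool (x = y)) / h) \<longlongrightarrow> ?Th (idx x) (idx y)) (at_right 0)"
    if "x \<in> states M i" "y \<in> states M i" for x y
  proof -
    have "idx x = idx y \<longleftrightarrow> x = y" using idx'(2) that by metis
    then show ?thesis using intensity[OF idx'(1)[OF that(1)] idx'(1)[OF that(2)]] idx'(2) that by simp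
  qed
  have D: "((\<lambda>h. (transition None h None - 1) / h) \<longlongrightarrow> 0) (at_right 0)"
  proof -
    have "M + 1 \<notin> {2..M - 1}" by auto
    then have "?Th (M + 1) (M + 1) = 0" by (simp only: Theta_def if_False)
    then show ?thesis using intensity[of "M + 1" "M + 1"] by (simp add: state_of_def)
  qed
  show ?thesis
    unfolding has_generator_def
  proof (intro allI impI ballI)
    fix f :: "real \<Rightarrow> real" and t x :: real
    assume t: "0 \<le> t" and x: "x \<in> grid M i"
    define F where "F n = (\<integral>\<omega>. extend f (Y t \<omega>) \<partial>P (?st n))" for n
    let ?m = "mean_value P Y f t"
    from x obtain j where j: "j \<in> {1..M}" and xj: "x = i j" by (auto simp: grid_def)
    have F_mean: "F n = ?m (i n)" if "n \<in> {1..M}" for n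
      using st_Some[OF that] by (simp add: F_def mean_value_def)
    have F0: "F (M + 1) = 0"
      using expectation_absorbing[OF _ t D, of "extend f"]
      by (simp add: F_def state_of_def states_def extend_def)
    have xE: "Some x \<in> states M i" using x by (simp add: states_def)
    have "(\<Sum>z\<in>states M i. ?Th (idx (Some x)) (idx z) * (\<integral>\<omega>. extend f (Y t \<omega>) \<partial>P z))
        = (\<Sum>n=1..M + 1. ?Th j n * F n)"
      using idx[of j] j st_Some[OF j] xj
      by (subst sum.reindex_bij_betw[OF bij, symmetric]) (auto simp: idx F_def intro!: sum.cong)
    then have deriv: "((\<lambda>s. mean_value P Y f s x) has_real_derivative (\<Sum>n=1..M + 1. ?Th j n * F n))
        (at t within {0..})"
      using backward_equation[OF Q xE t, of "extend f"] by (simp add: mean_value_def)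
    have grid: "grid_fun M i v x = v j" for v
      using the_inv_into_f_f[OF inj j] by (simp add: grid_fun_def xj)
    have "(\<Sum>n=1..M + 1. ?Th j n * F n) =
      a x * (1 / 2 * discrete_laplacian M i ?m x + bfun x * discrete_gradient M i ?m x - kfun x * ?m x)"
    proof (cases "j \<in> {2..M - 1}")
      case True
      have less: "i (j - 1) < i j" "i j < i (j + 1)"
        using True by (auto intro!: strict_mono_onD[OF assms(2)])
      have "F (j - 1) = ?m (i (j - 1))" "F j = ?m (i j)" "F (j + 1) = ?m (i (j + 1))"
        using True by (auto intro!: F_mean)
      then show ?thesis
        using Theta_eq_generator[where F = F and b = b and k = k and lam = lam, OF True F0 less]
          True assms(8,11,12)
        by (simp add: xj discrete_laplacian_def discrete_gradient_def grid[unfolded xj])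
    next
      case False
      then have "j = 1 \<or> j = M" using j by auto
      then have "a x = 0" using assms(9,10) xj by auto
      moreover have "?Th j n = 0" for n using False by (simp only: Theta_def if_False)
      ultimately show ?thesis by simp
    qed
    with deriv show "((\<lambda>s. mean_value P Y f s x) has_real_derivative
        a x * (1 / 2 * discrete_laplacian M i ?m x + bfun x * discrete_gradient M i ?m x - kfun x * ?m x))
        (at t within {0..})"
      by simp
  qed
qed

end
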